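(* Let $\rho\in(0,1)$ be the unique root in $(0,1)$ of $f(X)=X^3-4X^2+X+1$, and put $\sigma=(1-\rho)/\rho^4$ (which lies in $(0,1)$). Then $$13\,L(\rho)+L(\sigma)=\frac{5\pi^2}{3}.$$
   Context: $L$ is the real Rogers dilogarithm: for $0<x<1$, $L(x)=\operatorname{Li}_2(x)+\tfrac12\log x\,\log(1-x)$ with $\operatorname{Li}_2(x)=\sum_{n\ge1}x^n/n^2$, and $L(1)=\pi^2/6$. The polynomial $f$ has exactly one root in $(0,1)$, numerically $\rho=0.7261094450\ldots$, $\sigma=0.9853005201\ldots$. *)

theory Defs
  imports "HOL-Analysis.Analysis" "HOL-Computational_Algebra.Polynomial"
begin

text \<open>The real dilogarithm, meaningful where its series converges, i.e. for
  \<open>\<bar>x\<bar> \<le> 1\<close>; the index is shifted so that the sum starts at the term for 1.\<close>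

definition Li2 :: "real \<Rightarrow> real" where
  "Li2 x = (\<Sum>n. x ^ Suc n / (real (Suc n))\<^sup>2)"

text \<open>The real Rogers dilogarithm on \<open>0 < x \<le> 1\<close>; values elsewhere have no meaning.\<close>

definition rogers_L :: "real \<Rightarrow> real" where
  "rogers_L x = (if x = 1 then pi\<^sup>2 / 6 else Li2 x + 1 / 2 * ln x * ln (1 - x))"

text \<open>The polynomial \<open>X\<^sup>3 - 4 X\<^sup>2 + X + 1\<close>; coefficients are listed from the constant term up.\<close>

definition f_poly :: "real poly" where
  "f_poly = [:1, 1, -4, 1:]"

end

theory Submission
  imports Defs "HOL-Real_Asymp.Real_Asymp"
begin

text \<open>
  Why such an identity should exist: since \<open>\<sigma> = (1 - \<rho>) / \<rho>\<^sup>4\<close> and, by the cubic equation,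
  \<open>1 - \<sigma> = (1 - \<rho>)\<^sup>4 / \<rho>\<^sup>3\<close>, in the exterior square of the multiplicative group
  \<open>\<sigma> \<and> (1 - \<sigma>) = (3 - 16) (\<rho> \<and> (1 - \<rho>))\<close>. Hence \<open>13 [\<rho>] + [\<sigma>]\<close> lies in the kernel of
  \<open>[t] \<mapsto> t \<and> (1 - t)\<close>, that is, it represents an element of the Bloch group of the field
  \<open>\<rat>(\<rho>)\<close>. That field is cubic and totally real, so its Bloch group is torsion, and a multiple of
  \<open>13 [\<rho>] + [\<sigma>]\<close> must be a combination of five-term relations, which makes
  \<open>13 L(\<rho>) + L(\<sigma>)\<close> a rational multiple of \<open>\<pi>\<^sup>2\<close>.

  The proof exhibits such a combination of five-term relations, all of whose arguments \<open>t\<close> have both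
  \<open>t\<close> and \<open>1 - t\<close> in the group generated by the units \<open>\<rho>\<close>, \<open>1 - \<rho>\<close> and the three numbers \<open>1 + \<rho>\<close>,
  \<open>1 + \<rho> - \<rho>\<^sup>2\<close>, \<open>\<rho>\<^sup>2 + \<rho> - 1\<close>, which generate the primes above 5. Twelve relations suffice
  (\<open>rogers_L_ladder\<close>): in their signed sum all auxiliary arguments cancel and
  \<open>4 L(\<rho>) = 9 L(1 - \<rho>) + L(1 - \<sigma>)\<close> remains. Reflection, \<open>L(t) + L(1 - t) = \<pi>\<^sup>2 / 6\<close>, turns this
  into the claim.

  Reflection and the five-term relation are proved by differentiation: the derivative of \<open>L\<close> is
  elementary, the difference of the two sides has derivative zero on \<open>(0, 1)\<close>, and the constant is read
  off from the limit at 0. The only special value entering is \<open>L(1) = \<pi>\<^sup>2 / 6\<close>, the Basel sum.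
\<close>

section \<open>The Rogers dilogarithm and its derivative\<close>

lemma summable_inverse_squares_Suc: "summable (\<lambda>n. 1 / (real (Suc n))\<^sup>2)"
  using inverse_squares_sums by (simp add: sums_iff add.commute)

text \<open>The series converges uniformly by comparison with the Basel series, so continuity extends to the
  boundary point 1 of the disc of convergence.\<close>
lemma continuous_on_Li2: "continuous_on {0..1} Li2"
proof -
  have "uniform_limit {0..1} (\<lambda>n x. \<Sum>i<n. x ^ Suc i / (real (Suc i))\<^sup>2) Li2 sequentially"
    unfolding Li2_def
  proof (rule Weierstrass_m_test)
    show "summable (\<lambda>n. 1 / (real (Suc n))\<^sup>2)"
      by (rule summable_inverse_squares_Suc)
    show "norm (x ^ Suc n / (real (Suc n))\<^sup>2) \<le> 1 / (real (Suc n))\<^sup>2" if "x \<in> {0..1}" for n and x :: real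
      using that by (auto simp: abs_mult power_le_one mult_le_one intro!: divide_right_mono)
  qed
  then show ?thesis
    by (rule uniform_limit_theorem[rotated]) (auto intro!: always_eventually continuous_intros)
qed

lemma Li2_0: "Li2 0 = 0"
  by (simp add: Li2_def)

lemma Li2_1: "Li2 1 = pi\<^sup>2 / 6"
  using inverse_squares_sums by (simp add: Li2_def sums_iff add.commute)

text \<open>Differentiating the series termwise leaves the series of \<open>- ln (1 - x)\<close> divided by \<open>x\<close>.\<close>
lemma Li2_has_derivative:
  assumes "0 < x" "x < 1"
  shows "(Li2 has_real_derivative - ln (1 - x) / x) (at x)"
proof -
  have summable: "summable (\<lambda>n. 1 / (real (Suc n))\<^sup>2 * real (Suc n) * y ^ n)"
    if y: "y \<in> {-1<..<1}" for y :: real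
  proof (rule summable_comparison_test[OF exI])
    show "summable (\<lambda>n. \<bar>y\<bar> ^ n)" using y by (auto intro: summable_geometric)
    show "\<forall>n\<ge>0. norm (1 / (real (Suc n))\<^sup>2 * real (Suc n) * y ^ n) \<le> \<bar>y\<bar> ^ n"
      by (auto simp: abs_mult power_abs power2_eq_square divide_simps mult_le_cancel_left1)
  qed
  have "ln (1 - x) = (\<Sum>n. (-1) ^ n * (1 / real (n + 1)) * (1 - x - 1) ^ Suc n)"
    by (rule ln_series) (use assms in auto)
  also have "\<dots> = (\<Sum>n. - x * (1 / (real (Suc n))\<^sup>2 * real (Suc n) * x ^ n))"
  proof (rule suminf_cong)
    fix n
    have "(-1) ^ n * (- x) ^ n = x ^ n"
      by (simp flip: power_mult_distrib)
    then show "(-1) ^ n * (1 / real (n + 1)) * (1 - x - 1) ^ Suc n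
        = - x * (1 / (real (Suc n))\<^sup>2 * real (Suc n) * x ^ n)"
      by (simp add: power2_eq_square)
  qed
  also have "\<dots> = - x * (\<Sum>n. 1 / (real (Suc n))\<^sup>2 * real (Suc n) * x ^ n)"
    by (rule suminf_mult, rule summable) (use assms in auto)
  finally have "(\<Sum>n. 1 / (real (Suc n))\<^sup>2 * real (Suc n) * x ^ n) = - ln (1 - x) / x"
    using assms by (simp add: field_simps)
  moreover have "((\<lambda>x. \<Sum>n. 1 / (real (Suc n))\<^sup>2 * x ^ Suc n) has_real_derivative
      (\<Sum>n. 1 / (real (Suc n))\<^sup>2 * real (Suc n) * x ^ n)) (at x)"
    by (rule DERIV_power_series'[where R = 1]) (use assms summable in auto)
  ultimately show ?thesis by (simp add: Li2_def[abs_def])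
qed

text \<open>The product of logarithms makes the derivative invariant under \<open>x \<mapsto> 1 - x\<close>, and this is what
  makes the functional equations below free of logarithmic correction terms.\<close>
lemma rogers_L_has_derivative:
  assumes "0 < x" "x < 1"
  shows "(rogers_L has_real_derivative - (ln (1 - x) / x + ln x / (1 - x)) / 2) (at x)"
proof -
  have "((\<lambda>x. Li2 x + 1 / 2 * ln x * ln (1 - x)) has_real_derivative
      - (ln (1 - x) / x + ln x / (1 - x)) / 2) (at x)"
    by (rule derivative_eq_intros Li2_has_derivative refl | use assms in \<open>simp add: field_simps\<close>)+
  then show ?thesis
    by (rule has_field_derivative_transform_within_open[of _ _ _ "{0<..<1}"])
      (use assms in \<open>auto simp: rogers_L_def\<close>)
qed

text \<open>Here \<open>t'\<close> enters only through the logarithmic derivatives of \<open>t\<close> and \<open>1 - t\<close>,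
  as the exterior product \<open>t \<and> (1 - t)\<close> suggests.\<close>
lemma rogers_L_comp_has_derivative:
  assumes "(t has_real_derivative t') (at x)" "0 < t x" "t x < 1"
  shows "((\<lambda>x. rogers_L (t x)) has_real_derivative
      - (ln (1 - t x) * (t' / t x) + ln (t x) * (t' / (1 - t x))) / 2) (at x)"
  using DERIV_chain2[OF rogers_L_has_derivative[OF assms(2,3)] assms(1)]
  by (simp add: field_simps)

lemma rogers_L_tendsto_0: "(rogers_L \<longlongrightarrow> 0) (at_right 0)"
proof -
  have "(Li2 \<longlongrightarrow> 0) (at_right 0)"
    using continuous_on_Icc_at_rightD[OF continuous_on_Li2] by (simp add: Li2_0)
  moreover have "((\<lambda>x::real. ln x * ln (1 - x)) \<longlongrightarrow> 0) (at_right 0)"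
    by real_asymp
  ultimately have "((\<lambda>x. Li2 x + 1 / 2 * (ln x * ln (1 - x))) \<longlongrightarrow> 0 + 1 / 2 * 0) (at_right 0)"
    by (intro tendsto_intros)
  then show ?thesis
    by (rule filterlim_cong[THEN iffD1, rotated -1])
      (auto simp: rogers_L_def eventually_at_right_field intro!: exI[of _ 1])
qed

lemma rogers_L_tendsto_1: "(rogers_L \<longlongrightarrow> pi\<^sup>2 / 6) (at_left 1)"
proof -
  have "(Li2 \<longlongrightarrow> pi\<^sup>2 / 6) (at_left 1)"
    using continuous_on_Icc_at_leftD[OF continuous_on_Li2] by (simp add: Li2_1)
  moreover have "((\<lambda>x::real. ln x * ln (1 - x)) \<longlongrightarrow> 0) (at_left 1)"
    by real_asymp
  ultimately have "((\<lambda>x. Li2 x + 1 / 2 * (ln x * ln (1 - x))) \<longlongrightarrow> pi\<^sup>2 / 6 + 1 / 2 * 0) (at_left 1)"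
    by (intro tendsto_intros)
  then show ?thesis
    by (rule filterlim_cong[THEN iffD1, rotated -1])
      (auto simp: rogers_L_def eventually_at_left_field intro!: exI[of _ 0])
qed

section \<open>Functional equations\<close>

text \<open>Both functional equations are instances of this principle: a function with zero derivative is
  determined by its limit at the left end of the interval.\<close>
lemma eq_limit_at_right_0:
  fixes f :: "real \<Rightarrow> real"
  assumes deriv: "\<And>x. 0 < x \<Longrightarrow> x < 1 \<Longrightarrow> (f has_real_derivative 0) (at x)"
    and lim: "(f \<longlongrightarrow> l) (at_right 0)"
    and x: "0 < x" "x < 1"
  shows "f x = l"
proof -
  have "\<exists>c. \<forall>t\<in>{0<..<1}. f t = c"
    by (rule has_field_derivative_zero_constant)
      (auto intro: has_field_derivative_at_within deriv)
  then obtain c where c: "\<And>t. 0 < t \<Longrightarrow> t < 1 \<Longrightarrow> f t = c" by auto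
  have "(f \<longlongrightarrow> c) (at_right 0)"
    by (rule tendsto_eventually) (auto simp: eventually_at_right_field c intro!: exI[of _ 1])
  with lim have "l = c" by (intro tendsto_unique[of "at_right 0" f]) auto
  with c x show ?thesis by simp
qed

lemma rogers_L_reflection:
  assumes "0 < x" "x < 1"
  shows "rogers_L x + rogers_L (1 - x) = pi\<^sup>2 / 6"
proof (rule eq_limit_at_right_0[OF _ _ assms])
  fix x :: real assume x: "0 < x" "x < 1"
  show "((\<lambda>x. rogers_L x + rogers_L (1 - x)) has_real_derivative 0) (at x)"
    by (rule derivative_eq_intros rogers_L_comp_has_derivative refl | use x in \<open>simp add: field_simps\<close>)+
next
  have "filterlim (\<lambda>x::real. 1 - x) (at_left 1) (at_right 0)"
    by real_asymp
  from filterlim_compose[OF rogers_L_tendsto_1 this]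
  have "((\<lambda>x. rogers_L x + rogers_L (1 - x)) \<longlongrightarrow> 0 + pi\<^sup>2 / 6) (at_right 0)"
    by (intro tendsto_intros rogers_L_tendsto_0)
  then show "((\<lambda>x. rogers_L x + rogers_L (1 - x)) \<longlongrightarrow> pi\<^sup>2 / 6) (at_right 0)"
    by simp
qed

text \<open>For fixed \<open>y\<close>, differentiate in \<open>x\<close>. With \<open>d = 1 - x y\<close>, the last two arguments \<open>u\<close> and \<open>w\<close>
  satisfy \<open>1 - u = (1 - x) / d\<close> and \<open>1 - w = (1 - y) / d\<close>, so all logarithms occurring are
  combinations of the five logarithms of \<open>x\<close>, \<open>y\<close>, \<open>1 - x\<close>, \<open>1 - y\<close>, \<open>d\<close>, and the coefficient of each
  cancels. As \<open>x\<close> tends to 0, the arguments \<open>x\<close>, \<open>x y\<close> and \<open>u\<close> tend to 0 while \<open>w\<close> tends to \<open>y\<close>.\<close>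
lemma rogers_L_five_term:
  assumes x: "0 < x" "x < 1" and y: "0 < y" "y < 1"
  shows "rogers_L x + rogers_L y =
    rogers_L (x * y) + rogers_L (x * (1 - y) / (1 - x * y)) + rogers_L (y * (1 - x) / (1 - x * y))"
proof -
  define u where "u = (\<lambda>x. x * (1 - y) / (1 - x * y))"
  define w where "w = (\<lambda>x. y * (1 - x) / (1 - x * y))"
  define F where "F = (\<lambda>x. rogers_L x - rogers_L (x * y) - rogers_L (u x) - rogers_L (w x))"
  have "F x = - rogers_L y"
  proof (rule eq_limit_at_right_0[OF _ _ x])
    fix x :: real assume x: "0 < x" "x < 1"
    define d where "d = 1 - x * y"
    have xy: "x * y < y" using x y by simp
    have d: "0 < d" using y xy unfolding d_def by linarith
    have u1: "1 - u x = (1 - x) / d" and w1: "1 - w x = (1 - y) / d"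
      using d by (simp_all add: u_def w_def d_def field_simps)
    have u0: "u x = x * (1 - y) / d" and w0: "w x = y * (1 - x) / d"
      by (simp_all add: u_def w_def d_def)
    have pos: "0 < u x" "0 < 1 - u x" "0 < w x" "0 < 1 - w x"
      unfolding u1 w1 unfolding u0 w0 using x y d by simp_all
    have dd: "((\<lambda>x. 1 - x * y) has_real_derivative - y) (at x)"
      and du': "((\<lambda>x. x * (1 - y)) has_real_derivative 1 - y) (at x)"
      and dw': "((\<lambda>x. y * (1 - x)) has_real_derivative - y) (at x)"
      by (auto intro!: derivative_eq_intros)
    have "((1 - y) * (1 - x * y) - x * (1 - y) * - y) = 1 - y"
      by algebra
    then have du: "(u has_real_derivative (1 - y) / d\<^sup>2) (at x)"
      using DERIV_divide[OF du' dd] d by (simp add: u_def d_def power2_eq_square)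
    have "(- y * (1 - x * y) - y * (1 - x) * - y) = - (y * (1 - y))"
      by algebra
    then have dw: "(w has_real_derivative - (y * (1 - y) / d\<^sup>2)) (at x)"
      using DERIV_divide[OF dw' dd] d by (simp add: w_def d_def power2_eq_square)
    have dz: "((\<lambda>x. x * y) has_real_derivative y) (at x)"
      by (auto intro!: derivative_eq_intros)
    define G :: "real \<Rightarrow> real \<Rightarrow> real" where "G = (\<lambda>t t'. - (ln (1 - t) * (t' / t) + ln t * (t' / (1 - t))) / 2)"
    have "(F has_real_derivative G x 1 - G (x * y) y - G (u x) ((1 - y) / d\<^sup>2)
        - G (w x) (- (y * (1 - y) / d\<^sup>2))) (at x)"
      unfolding F_def G_def
      by (intro DERIV_diff rogers_L_comp_has_derivative du dw dz DERIV_ident)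
        (use x y d pos in \<open>auto simp: d_def\<close>)
    moreover have "G x 1 - G (x * y) y - G (u x) ((1 - y) / d\<^sup>2) - G (w x) (- (y * (1 - y) / d\<^sup>2)) = 0"
    proof -
      define lx ly mx my md where "lx = ln x" and "ly = ln y" and "mx = ln (1 - x)"
        and "my = ln (1 - y)" and "md = ln d"
      note l = lx_def[symmetric] ly_def[symmetric] mx_def[symmetric] my_def[symmetric] md_def[symmetric]
      have Gx: "G x 1 = - (mx / x + lx / (1 - x)) / 2"
        by (simp add: G_def l)
      have Gz: "G (x * y) y = - (md / x + (lx + ly) * (y / d)) / 2"
        using x y by (simp add: G_def ln_mult l flip: d_def)
      have Gu: "G (u x) ((1 - y) / d\<^sup>2) =
          - ((mx - md) * (1 / (x * d)) + (lx + my - md) * ((1 - y) / (d * (1 - x)))) / 2"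
        unfolding G_def u1 unfolding u0 using x y d
        by (simp add: ln_mult ln_div l power2_eq_square)
      have Gw: "G (w x) (- (y * (1 - y) / d\<^sup>2)) =
          - ((my - md) * (- ((1 - y) / (d * (1 - x)))) + (ly + mx - md) * (- (y / d))) / 2"
        unfolding G_def w1 unfolding w0 using x y d
        by (simp add: ln_mult ln_div l power2_eq_square)
      have e1: "1 / (x * d) = 1 / x + y / d" and e2: "(1 - y) / (d * (1 - x)) = 1 / (1 - x) - y / d"
        using x d by (simp_all add: d_def field_simps)
      show ?thesis unfolding Gx Gz Gu Gw e1 e2
        by (simp add: algebra_simps add_divide_distrib diff_divide_distrib)
    qed
    ultimately show "(F has_real_derivative 0) (at x)" by simp
  next
    have z: "filterlim (\<lambda>x. x * y) (at_right 0) (at_right 0)"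
      using y by real_asymp
    have u: "filterlim u (at_right 0) (at_right 0)"
      unfolding u_def using y by real_asymp
    have w: "(w \<longlongrightarrow> y) (at_right 0)"
      unfolding w_def by (rule tendsto_eq_intros refl | simp)+
    have "isCont rogers_L y"
      by (rule DERIV_isCont[OF rogers_L_has_derivative[OF y]])
    then have "((\<lambda>x. rogers_L (w x)) \<longlongrightarrow> rogers_L y) (at_right 0)"
      by (rule isCont_tendsto_compose[OF _ w])
    then have "(F \<longlongrightarrow> 0 - 0 - 0 - rogers_L y) (at_right 0)"
      unfolding F_def
      by (intro tendsto_diff filterlim_compose[OF rogers_L_tendsto_0 z]
          filterlim_compose[OF rogers_L_tendsto_0 u] rogers_L_tendsto_0)
    then show "(F \<longlongrightarrow> - rogers_L y) (at_right 0)" by simp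
  qed
  then show ?thesis by (simp add: F_def u_def w_def)
qed

text \<open>Clearing denominators makes the side conditions polynomial identities, which can be checked
  modulo a polynomial equation for the arguments.\<close>
lemma rogers_L_five_term_implicit:
  assumes x: "0 < x" "x < 1" and y: "0 < y" "y < 1"
    and z: "x * y = z" and u: "u * (1 - z) = x * (1 - y)" and w: "w * (1 - z) = y * (1 - x)"
  shows "rogers_L x + rogers_L y = rogers_L z + rogers_L u + rogers_L w"
proof -
  have "x * y < 1 * 1" by (rule mult_strict_mono) (use x y in auto)
  then have "1 - z \<noteq> 0" using z by simp
  with u w have "u = x * (1 - y) / (1 - z)" "w = y * (1 - x) / (1 - z)"
    by (simp_all add: eq_divide_eq)
  with rogers_L_five_term[OF x y] z show ?thesis by simp
qed

section \<open>The cubic and its root\<close>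

text \<open>The cubic at \<open>x\<close> minus the cubic at \<open>a\<close> is \<open>x - a\<close> times a quadratic factor. That factor is negative
  as soon as one of the two points exceeds a half; for two roots this gives uniqueness, and for a
  rational \<open>a\<close> it says on which side of \<open>a\<close> the root lies.\<close>
lemma root_factor:
  fixes x a :: real
  assumes "x ^ 3 - 4 * x\<^sup>2 + x + 1 = 0"
  shows "(x - a) * (x\<^sup>2 + x * a + a\<^sup>2 - 4 * (x + a) + 1) = - (a ^ 3 - 4 * a\<^sup>2 + a + 1)"
  using assms by algebra

lemma root_factor_neg:
  fixes x a :: real
  assumes "0 < x" "x < 1" "1 / 2 < a" "a < 1"
  shows "x\<^sup>2 + x * a + a\<^sup>2 - 4 * (x + a) + 1 < 0"
proof -
  have "x\<^sup>2 < x" "x * a < x" "a\<^sup>2 < a" using assms by (auto simp: power2_eq_square)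
  then have "x\<^sup>2 + x * a + a\<^sup>2 - 4 * (x + a) + 1 < x + x + a - 4 * (x + a) + 1"
    by (intro add_strict_right_mono diff_strict_right_mono add_strict_mono)
  also have "\<dots> < 0" using assms by simp
  finally show ?thesis .
qed

lemma root_bounds:
  fixes r :: real
  assumes "0 < r" "r < 1" "r ^ 3 - 4 * r\<^sup>2 + r + 1 = 0"
  shows "7261 / 10000 < r" "r < 72611 / 100000"
proof -
  have "(r - 7261 / 10000) * (r\<^sup>2 + r * (7261 / 10000) + (7261 / 10000)\<^sup>2 - 4 * (r + 7261 / 10000) + 1) < 0"
    unfolding root_factor[OF assms(3)] by (simp add: power2_eq_square power3_eq_cube)
  then show "7261 / 10000 < r"
    using root_factor_neg[of r "7261 / 10000"] assms by (auto simp: mult_less_0_iff)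
  have "0 < (r - 72611 / 100000) * (r\<^sup>2 + r * (72611 / 100000) + (72611 / 100000)\<^sup>2 - 4 * (r + 72611 / 100000) + 1)"
    unfolding root_factor[OF assms(3)] by (simp add: power2_eq_square power3_eq_cube)
  then show "r < 72611 / 100000"
    using root_factor_neg[of r "72611 / 100000"] assms by (auto simp: zero_less_mult_iff)
qed

section \<open>The ladder\<close>

text \<open>
  Every auxiliary argument is a quadratic polynomial in \<open>r\<close> (possibly divided by 5), its reduced form modulo
  the cubic; in this form the side conditions of the five-term relation reduce mechanically. What cannot
  be seen from these polynomials is that they are products of powers of \<open>r\<close>, \<open>1 - r\<close>, \<open>1 + r\<close>,
  \<open>p = 1 + r - r\<^sup>2\<close> and \<open>q = r\<^sup>2 + r - 1\<close>. Where it is not evident, the arguments \<open>x\<close> and \<open>y\<close> on the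
  left hand side of a relation are given in that form before it; they determine the three on the right.
  The argument \<open>41 - 66 r + 15 r\<^sup>2\<close> is \<open>\<sigma> = (1 - r) / r\<^sup>4\<close>.

  The rational bounds on \<open>r\<close> serve to show that the arguments lie in \<open>(0, 1)\<close>; their precision is dictated
  by \<open>\<sigma>\<close>, which is within 0.015 of 1 and has coefficients as large as 66.
\<close>
lemma rogers_L_ladder:
  fixes r :: real
  assumes r: "7261 / 10000 < r" "r < 72611 / 100000" and f: "r ^ 3 - 4 * r\<^sup>2 + r + 1 = 0"
  shows "13 * rogers_L r + rogers_L (41 - 66 * r + 15 * r\<^sup>2) = 5 * pi\<^sup>2 / 3"
proof -
  have "(7261 / 10000)\<^sup>2 < r\<^sup>2" "r\<^sup>2 < (72611 / 100000)\<^sup>2"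
    by (rule power_strict_mono; use r in simp)+
  then have r2: "5272 / 10000 < r\<^sup>2" "r\<^sup>2 < 52724 / 100000"
    by (simp_all add: power2_eq_square)
  \<comment> \<open>Rewriting with the cubic reduces powers of \<open>r\<close> inside right-nested products; the version with a
    trailing factor \<open>c\<close> is needed because normalisation may put further factors there.\<close>
  have cube: "r * (r * r) = 4 * (r * r) - r - 1"
    using f by (simp add: power2_eq_square power3_eq_cube)
  then have "r * (r * (r * c)) = (4 * (r * r) - r - 1) * c" for c
    by (metis mult.assoc)
  note reduce = power2_eq_square algebra_simps add_divide_distrib diff_divide_distrib cube this
  \<comment> \<open>\<open>x = r, y = r / (1 + r)\<close>\<close>
  have R1: "rogers_L r + rogers_L ((- 1 + 5 * r - r\<^sup>2) / 5) =
      rogers_L ((1 + r\<^sup>2) / 5) + rogers_L ((- 1 + 7 * r - 2 * r\<^sup>2) / 5) + rogers_L ((- 3 + 6 * r - r\<^sup>2) / 5)"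
    by (rule rogers_L_five_term_implicit; (use r r2 in \<open>simp; fail\<close> | simp add: reduce))
  \<comment> \<open>\<open>x = r / p, y = (1 - r)\<^sup>2 p / (r q)\<close>\<close>
  have R2: "rogers_L ((- 1 + 7 * r - 2 * r\<^sup>2) / 5) + rogers_L ((7 - 7 * r + r\<^sup>2) / 5) =
      rogers_L ((- 4 + 9 * r - 2 * r\<^sup>2) / 5) + rogers_L ((2 + r - r\<^sup>2) / 5) + rogers_L (1 - r)"
    by (rule rogers_L_five_term_implicit; (use r r2 in \<open>simp; fail\<close> | simp add: reduce))
  \<comment> \<open>\<open>x = (1 - r) / r, y = 1 - r\<close>\<close>
  have R3: "rogers_L (- 2 + 4 * r - r\<^sup>2) + rogers_L (1 - r) =
      rogers_L (- 3 + 5 * r - r\<^sup>2) + rogers_L ((1 + r\<^sup>2) / 5) + rogers_L ((3 - 5 * r + 3 * r\<^sup>2) / 5)"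
    by (rule rogers_L_five_term_implicit; (use r r2 in \<open>simp; fail\<close> | simp add: reduce))
  \<comment> \<open>\<open>x = q / (r (1 + r)), y = (1 - r)\<^sup>4 (1 + r) / (r\<^sup>2 q)\<close>\<close>
  have R4: "rogers_L ((16 - 25 * r + 6 * r\<^sup>2) / 5) + rogers_L ((- 38 + 63 * r - 14 * r\<^sup>2) / 5) =
      rogers_L (- 40 + 66 * r - 15 * r\<^sup>2) + rogers_L ((3 - 5 * r + 3 * r\<^sup>2) / 5) + rogers_L ((3 - 3 * r - r\<^sup>2) / 5)"
    by (rule rogers_L_five_term_implicit; (use r r2 in \<open>simp; fail\<close> | simp add: reduce))
  \<comment> \<open>\<open>x = r\<^sup>2, y = ((1 - r) / r)\<^sup>2\<close>\<close>
  have R5: "rogers_L (r\<^sup>2) + rogers_L (8 - 13 * r + 3 * r\<^sup>2) =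
      rogers_L ((1 - r)\<^sup>2) + rogers_L ((7 - 7 * r + r\<^sup>2) / 5) + rogers_L ((- 38 + 63 * r - 14 * r\<^sup>2) / 5)"
    by (rule rogers_L_five_term_implicit; (use r r2 in \<open>simp; fail\<close> | simp add: reduce))
  \<comment> \<open>\<open>x = y = (1 - r) / r\<close>\<close>
  have R6: "rogers_L (- 2 + 4 * r - r\<^sup>2) + rogers_L (- 2 + 4 * r - r\<^sup>2) =
      rogers_L (8 - 13 * r + 3 * r\<^sup>2) + rogers_L (1 - r) + rogers_L (1 - r)"
    by (rule rogers_L_five_term_implicit; (use r r2 in \<open>simp; fail\<close> | simp add: reduce))
  \<comment> \<open>\<open>x = (1 - r) / r\<^sup>2, y = r\<^sup>2 / p\<close>\<close>
  have R7: "rogers_L (6 - 9 * r + 2 * r\<^sup>2) + rogers_L ((2 + r - r\<^sup>2) / 5) =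
      rogers_L ((9 - 13 * r + 3 * r\<^sup>2) / 5) + rogers_L (- 2 + 4 * r - r\<^sup>2) + rogers_L (1 - r)"
    by (rule rogers_L_five_term_implicit; (use r r2 in \<open>simp; fail\<close> | simp add: reduce))
  \<comment> \<open>\<open>x = (1 - r) (1 + r) / r, y = r / (1 + r)\<close>\<close>
  have R8: "rogers_L (- 1 + 3 * r - r\<^sup>2) + rogers_L ((- 1 + 5 * r - r\<^sup>2) / 5) =
      rogers_L (1 - r) + rogers_L (6 - 9 * r + 2 * r\<^sup>2) + rogers_L ((16 - 25 * r + 6 * r\<^sup>2) / 5)"
    by (rule rogers_L_five_term_implicit; (use r r2 in \<open>simp; fail\<close> | simp add: reduce))
  \<comment> \<open>\<open>x = 1 - r, y = r (1 - r)\<^sup>2 / q\<close>\<close>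
  have R9: "rogers_L (1 - r) + rogers_L ((2 - 2 * r + r\<^sup>2) / 5) =
      rogers_L ((3 - 3 * r - r\<^sup>2) / 5) + rogers_L ((9 - 13 * r + 3 * r\<^sup>2) / 5) + rogers_L ((- 3 + 6 * r - r\<^sup>2) / 5)"
    by (rule rogers_L_five_term_implicit; (use r r2 in \<open>simp; fail\<close> | simp add: reduce))
  have R10: "rogers_L (1 - r) + rogers_L (1 - r) =
      rogers_L ((1 - r)\<^sup>2) + rogers_L ((2 - 2 * r + r\<^sup>2) / 5) + rogers_L ((2 - 2 * r + r\<^sup>2) / 5)"
    by (rule rogers_L_five_term_implicit; (use r r2 in \<open>simp; fail\<close> | simp add: reduce))
  \<comment> \<open>\<open>x = r, y = (1 - r)\<^sup>2 / q\<close>\<close>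
  have R11: "rogers_L r + rogers_L ((- 4 + 9 * r - 2 * r\<^sup>2) / 5) =
      rogers_L ((2 - 2 * r + r\<^sup>2) / 5) + rogers_L (- 1 + 3 * r - r\<^sup>2) + rogers_L (- 3 + 5 * r - r\<^sup>2)"
    by (rule rogers_L_five_term_implicit; (use r r2 in \<open>simp; fail\<close> | simp add: reduce))
  have R12: "rogers_L r + rogers_L r =
      rogers_L (r\<^sup>2) + rogers_L ((- 1 + 5 * r - r\<^sup>2) / 5) + rogers_L ((- 1 + 5 * r - r\<^sup>2) / 5)"
    by (rule rogers_L_five_term_implicit; (use r r2 in \<open>simp; fail\<close> | simp add: reduce))

  \<comment> \<open>The third, ninth and tenth relation are subtracted, the others added.\<close>
  have "4 * rogers_L r = 9 * rogers_L (1 - r) + rogers_L (- 40 + 66 * r - 15 * r\<^sup>2)"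
    using R1 R2 R3 R4 R5 R6 R7 R8 R9 R10 R11 R12 by linarith
  moreover have "rogers_L r + rogers_L (1 - r) = pi\<^sup>2 / 6"
    by (rule rogers_L_reflection) (use r in linarith)+
  moreover have "rogers_L (41 - 66 * r + 15 * r\<^sup>2) + rogers_L (1 - (41 - 66 * r + 15 * r\<^sup>2)) = pi\<^sup>2 / 6"
    by (rule rogers_L_reflection) (use r r2 in linarith)+
  moreover have "1 - (41 - 66 * r + 15 * r\<^sup>2) = - 40 + 66 * r - 15 * r\<^sup>2"
    by simp
  ultimately show ?thesis
    by simp
qed

theorem theorem2p2:
  shows "(\<exists>!\<rho>::real. 0 < \<rho> \<and> \<rho> < 1 \<and> poly f_poly \<rho> = 0) \<and>
    (\<forall>\<rho> \<sigma> :: real.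
       0 < \<rho> \<and> \<rho> < 1 \<and> poly f_poly \<rho> = 0 \<and> \<sigma> = (1 - \<rho>) / \<rho> ^ 4 \<longrightarrow>
       0 < \<sigma> \<and> \<sigma> < 1 \<and>
       13 * rogers_L \<rho> + rogers_L \<sigma> = 5 * pi\<^sup>2 / 3)"
proof (intro conjI allI impI)
  have poly_f: "poly f_poly x = x ^ 3 - 4 * x\<^sup>2 + x + 1" for x
    by (simp add: f_poly_def algebra_simps power2_eq_square power3_eq_cube)
  show "\<exists>!\<rho>::real. 0 < \<rho> \<and> \<rho> < 1 \<and> poly f_poly \<rho> = 0"
  proof (rule ex_ex1I)
    have "\<exists>x. 0 < x \<and> x < 1 \<and> poly f_poly x = 0"
      by (rule poly_IVT_neg) (auto simp: f_poly_def)
    then show "\<exists>\<rho>. 0 < \<rho> \<and> \<rho> < 1 \<and> poly f_poly \<rho> = 0" .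
  next
    fix x y :: real
    assume x: "0 < x \<and> x < 1 \<and> poly f_poly x = 0" and y: "0 < y \<and> y < 1 \<and> poly f_poly y = 0"
    then have fx: "x ^ 3 - 4 * x\<^sup>2 + x + 1 = 0" and fy: "y ^ 3 - 4 * y\<^sup>2 + y + 1 = 0"
      by (simp_all add: poly_f)
    have "7261 / 10000 < y" by (rule root_bounds) (use y fy in auto)
    then have "x\<^sup>2 + x * y + y\<^sup>2 - 4 * (x + y) + 1 < 0"
      using x y by (intro root_factor_neg) auto
    with root_factor[OF fx, of y] fy show "x = y" by auto
  qed
next
  fix \<rho> \<sigma> :: real
  assume asm: "0 < \<rho> \<and> \<rho> < 1 \<and> poly f_poly \<rho> = 0 \<and> \<sigma> = (1 - \<rho>) / \<rho> ^ 4"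
  then have f: "\<rho> ^ 3 - 4 * \<rho>\<^sup>2 + \<rho> + 1 = 0"
    by (simp add: f_poly_def algebra_simps power2_eq_square power3_eq_cube)
  note bounds = root_bounds[OF _ _ f]
  have "(41 - 66 * \<rho> + 15 * \<rho>\<^sup>2) * \<rho> ^ 4 = 1 - \<rho>"
    using f by algebra
  with asm have \<sigma>: "\<sigma> = 41 - 66 * \<rho> + 15 * \<rho>\<^sup>2"
    by (simp add: divide_eq_eq)
  have "(1 - \<sigma>) * \<rho> ^ 3 = (1 - \<rho>) ^ 4"
    unfolding \<sigma> using f by algebra
  moreover have "0 < (1 - \<rho>) ^ 4" "0 < \<rho> ^ 3" using asm by simp_all
  ultimately show "\<sigma> < 1"
    by (metis diff_gt_0_iff_gt zero_less_mult_pos2)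
  show "0 < \<sigma>" using asm by simp
  show "13 * rogers_L \<rho> + rogers_L \<sigma> = 5 * pi\<^sup>2 / 3"
    unfolding \<sigma> using asm bounds f by (intro rogers_L_ladder) auto
qed

end
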